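(* Let $\alpha, w, M, C_1>0$. Suppose $Y$ and $Z$ are independent real random variables, the moment generating function $\phi_Z$ of $Z$ satisfies $\phi_Z(t)\le e^{C_1\alpha t^2}$ for all $-M\le t\le 0$, and $Y$ satisfies the tail inequality $\mathbb{P}(Y\ge x)\ge T(x)$ for all $x\ge w\alpha$, where $T$ is a real-valued function on $[w\alpha,\infty)$. Then $X=Y+Z$ satisfies $$\mathbb{P}(X\ge x)\ge \left(1-\exp\left(-\min\left\{\frac{w^2}{16C_1},\frac{Mw}{4}\right\}\alpha\right)\right)T(2x),\qquad \forall\, x\ge \frac{w\alpha}{2}.$$
   Context: The moment generating function of $Z$ is $\phi_Z(t)=\mathbb{E}\exp(tZ)$. *)

theory Defs
  imports "HOL-Probability.Probability"
begin

(* Valued in [0, \<infinity>], so that an upper bound on mgf P Z t entails integrability of exp (t * Z);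
   the Bochner integral would return 0 for a divergent expectation. *)
definition mgf :: "'a measure \<Rightarrow> ('a \<Rightarrow> real) \<Rightarrow> real \<Rightarrow> ennreal" where
  "mgf P Z t = (\<integral>\<^sup>+ \<omega>. ennreal (exp (t * Z \<omega>)) \<partial>P)"

end

theory Submission
  imports Defs
begin

text \<open>
  If \<open>Y \<ge> 2 * x\<close> and \<open>Z > - x\<close>, then \<open>Y + Z \<ge> x\<close>; by independence
  \<open>P (Y + Z \<ge> x) \<ge> P (Y \<ge> 2 * x) * P (Z > - x)\<close>. Doubling the threshold thus leaves room
  for a downward fluctuation of \<open>Z\<close> of size \<open>x\<close>, and it remains to see that a larger
  one is unlikely. That is a Chernoff bound with a negative exponent \<open>- s\<close>: for
  \<open>x \<ge> w * \<alpha> / 2\<close> it gives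
  \<open>P (Z \<le> - x) \<le> exp (\<alpha> * (C\<^sub>1 * s\<^sup>2 - s * w / 2))\<close>. The unconstrained optimum is
  \<open>s = w / (4 * C\<^sub>1)\<close>, and since the moment generating function is controlled only up to \<open>M\<close>,
  the right choice is \<open>s = min M (w / (4 * C\<^sub>1))\<close>. In both regimes the quadratic term is at most half
  of the linear one, which leaves \<open>exp (- \<alpha> * s * w / 4)\<close>; inserting the two values of \<open>s\<close>
  produces the minimum in the statement.
\<close>

lemma (in prob_space) prob_le_exp_mgf:
  assumes Z: "random_variable borel Z" and "s > 0" and "0 \<le> B"
    and mgf: "mgf M Z (- s) \<le> ennreal B"
  shows "\<P>(\<omega> in M. Z \<omega> \<le> a) \<le> exp (s * a) * B"
proof -
  have "emeasure M {\<omega> \<in> space M. Z \<omega> \<le> a} \<le>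
      ennreal (exp (s * a)) * (\<integral>\<^sup>+ \<omega>. ennreal (exp (- s * Z \<omega>)) * indicator (space M) \<omega> \<partial>M)"
    using Z \<open>s > 0\<close> by (intro Chernoff_ineq_nn_integral_le) auto
  also have "(\<integral>\<^sup>+ \<omega>. ennreal (exp (- s * Z \<omega>)) * indicator (space M) \<omega> \<partial>M) = mgf M Z (- s)"
    unfolding mgf_def by (intro nn_integral_cong) simp
  also have "ennreal (exp (s * a)) * \<dots> \<le> ennreal (exp (s * a)) * ennreal B"
    using mgf by (intro mult_left_mono) auto
  also have "\<dots> = ennreal (exp (s * a) * B)"
    using \<open>0 \<le> B\<close> by (simp add: ennreal_mult)
  finally show ?thesis
    using \<open>0 \<le> B\<close> by (simp add: emeasure_eq_measure)
qed

text \<open>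
  The cap \<open>s \<le> w / (4 * C)\<close> makes the quadratic cost \<open>C * \<alpha> * s\<^sup>2\<close> at most half of the linear
  gain \<open>s * x\<close>, whether or not the constraint \<open>s \<le> K\<close> is the binding one.
\<close>

lemma (in prob_space) prob_le_exp_of_subgaussian_mgf:
  fixes \<alpha> w K C x :: real
  assumes Z: "random_variable borel Z"
    and pos: "\<alpha> > 0" "w > 0" "K > 0" "C > 0"
    and mgf: "\<And>t. - K \<le> t \<Longrightarrow> t \<le> 0 \<Longrightarrow> mgf M Z t \<le> ennreal (exp (C * \<alpha> * t\<^sup>2))"
    and x: "x \<ge> w * \<alpha> / 2"
  shows "\<P>(\<omega> in M. Z \<omega> \<le> - x) \<le> exp (- min (w\<^sup>2 / (16 * C)) (K * w / 4) * \<alpha>)"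
proof -
  define s where "s = min K (w / (4 * C))"
  have s: "s > 0" "s \<le> K" "s \<le> w / (4 * C)"
    using pos by (auto simp: s_def)
  have "\<P>(\<omega> in M. Z \<omega> \<le> - x) \<le> exp (s * (- x)) * exp (C * \<alpha> * s\<^sup>2)"
    using prob_le_exp_mgf[OF Z \<open>s > 0\<close>, of "exp (C * \<alpha> * s\<^sup>2)" "- x"] mgf[of "- s"] s by simp
  also have "\<dots> = exp (C * \<alpha> * s\<^sup>2 - s * x)"
    by (simp add: exp_add[symmetric])
  also have "\<dots> \<le> exp (- (s * w / 4) * \<alpha>)"
  proof -
    have "C * s \<le> w / 4"
      using s(3) pos by (simp add: field_simps)
    then have "(\<alpha> * s) * (C * s) \<le> (\<alpha> * s) * (w / 4)"
      using pos s by (intro mult_left_mono) auto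
    moreover have "s * (w * \<alpha> / 2) \<le> s * x"
      using x s by (intro mult_left_mono) auto
    ultimately show ?thesis
      by (simp add: power2_eq_square algebra_simps)
  qed
  also have "s * w / 4 = min (w\<^sup>2 / (16 * C)) (K * w / 4)"
    using pos by (auto simp: s_def min_def field_simps power2_eq_square)
  finally show ?thesis .
qed

lemma (in prob_space) indep_var_prob_sum_ge:
  fixes Y Z :: "'a \<Rightarrow> real"
  assumes indep: "indep_var borel Y borel Z"
  shows "\<P>(\<omega> in M. Y \<omega> \<ge> a) * (1 - \<P>(\<omega> in M. Z \<omega> \<le> b)) \<le> \<P>(\<omega> in M. Y \<omega> + Z \<omega> \<ge> a + b)"
proof -
  have [measurable]: "random_variable borel Y" "random_variable borel Z"
    using indep by (auto dest: indep_var_rv1 indep_var_rv2)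
  have "1 - \<P>(\<omega> in M. Z \<omega> \<le> b) = \<P>(\<omega> in M. Z \<omega> > b)"
    using prob_neg[of "\<lambda>\<omega>. Z \<omega> \<le> b"] by (simp add: not_le)
  then have "\<P>(\<omega> in M. Y \<omega> \<ge> a) * (1 - \<P>(\<omega> in M. Z \<omega> \<le> b)) =
      prob (Y -` {a..} \<inter> space M) * prob (Z -` {b<..} \<inter> space M)"
    by (auto intro!: arg_cong2[where f = "(*)"] arg_cong[where f = prob])
  also have "\<dots> = prob ((\<lambda>\<omega>. (Y \<omega>, Z \<omega>)) -` ({a..} \<times> {b<..}) \<inter> space M)"
    by (rule indep_varD[OF indep, symmetric]) auto
  also have "\<dots> \<le> \<P>(\<omega> in M. Y \<omega> + Z \<omega> \<ge> a + b)"
    by (intro finite_measure_mono) auto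
  finally show ?thesis .
qed

theorem theorem2:
  fixes P :: "'a measure" and X Y Z :: "'a \<Rightarrow> real"
    and \<alpha> w M C\<^sub>1 :: real and T :: "real \<Rightarrow> real"
  assumes "prob_space P"
    and "\<alpha> > 0" and "w > 0" and "M > 0" and "C\<^sub>1 > 0"
    and "prob_space.indep_var P borel Y borel Z"
    and "\<And>t. - M \<le> t \<Longrightarrow> t \<le> 0 \<Longrightarrow> mgf P Z t \<le> ennreal (exp (C\<^sub>1 * \<alpha> * t\<^sup>2))"
    and "\<And>x. x \<ge> w * \<alpha> \<Longrightarrow> \<P>(\<omega> in P. Y \<omega> \<ge> x) \<ge> T x"
    and "X = (\<lambda>\<omega>. Y \<omega> + Z \<omega>)"
  shows "\<forall>x \<ge> w * \<alpha> / 2.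
    \<P>(\<omega> in P. X \<omega> \<ge> x) \<ge> (1 - exp (- min (w\<^sup>2 / (16 * C\<^sub>1)) (M * w / 4) * \<alpha>)) * T (2 * x)"
proof (intro allI impI)
  interpret prob_space P by fact
  fix x assume x: "x \<ge> w * \<alpha> / 2"
  define q where "q = exp (- min (w\<^sup>2 / (16 * C\<^sub>1)) (M * w / 4) * \<alpha>)"
  have "\<P>(\<omega> in P. Z \<omega> \<le> - x) \<le> q"
    unfolding q_def using indep_var_rv2[OF assms(6)] assms(2-5,7) x
    by (intro prob_le_exp_of_subgaussian_mgf)
  have "q \<le> 1"
    using assms(2-5) by (simp add: q_def)
  (* T may be negative, so the factor 1 - q must be known to be nonnegative here. *)
  then have "(1 - q) * T (2 * x) \<le> (1 - q) * \<P>(\<omega> in P. Y \<omega> \<ge> 2 * x)"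
    using assms(8)[of "2 * x"] x by (intro mult_left_mono) auto
  also have "\<dots> \<le> \<P>(\<omega> in P. Y \<omega> \<ge> 2 * x) * (1 - \<P>(\<omega> in P. Z \<omega> \<le> - x))"
    using \<open>\<P>(\<omega> in P. Z \<omega> \<le> - x) \<le> q\<close>
    by (subst mult.commute, intro mult_left_mono) auto
  also have "\<dots> \<le> \<P>(\<omega> in P. X \<omega> \<ge> x)"
    using indep_var_prob_sum_ge[OF assms(6), of "2 * x" "- x"] assms(9) by simp
  finally show "(1 - exp (- min (w\<^sup>2 / (16 * C\<^sub>1)) (M * w / 4) * \<alpha>)) * T (2 * x)
      \<le> \<P>(\<omega> in P. X \<omega> \<ge> x)"
    by (simp only: q_def)
qed

end
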